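(* Let $T\in\mathbb{N}$ and $t_0\in\{0,\dots,T-1\}$, let $X\subset\mathbb{R}^n$, $U\subset\mathbb{R}^m$, $f:\mathbb{R}^n\times\mathbb{R}^m\times\mathbb{N}\to\mathbb{R}^n$, $c_t:\mathbb{R}^n\times\mathbb{R}^m\to\mathbb{R}$ for $t=t_0,\dots,T-1$, and $c_T:\mathbb{R}^n\to\mathbb{R}$. Consider the problems $P(t,x)$ defined in the context, with optimal values $J^*_{t,x}$, and define $F(x,t)=J^*_{t,x}$ for $x\in X$, $t\in\{t_0,\dots,T\}$. Then for all $x\in X$: $$F(x,t)=\inf_{u\in\Gamma_{t,x}}\{c_t(x,u)+F(f(x,u,t),t+1)\}\quad\text{for all }t\in\{t_0,\dots,T-1\},$$ $$F(x,T)=c_T(x).$$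
   Context: For $t\in\{t_0,\dots,T-1\}$ and $x_0\in\mathbb{R}^n$, $P(t,x_0)$ is the problem of minimizing $$J_{t,x_0}(\mathbf{u},\mathbf{x})=\sum_{k=t}^{T-1}c_k(x(k),u(k))+c_T(x(T))$$ over $\mathbf{u}=(u(t),\dots,u(T-1))$ and $\mathbf{x}=(x(t),\dots,x(T))$ subject to $x(t)=x_0$; $x(k+1)=f[x(k),u(k),k]$ for $k=t,\dots,T-1$; $x(k)\in X$ for $k=t+1,\dots,T$; $u(k)\in U$ for $k=t,\dots,T-1$. For $t=T$ there are no inputs and $J_{T,x}=J^*_{T,x}=c_T(x)$. A pair $(\mathbf{u}^*,\mathbf{x}^* )$ solves $P(t,x_0)$ if it is feasible and attains the minimum of $J_{t,x_0}$ over feasible pairs, and then $J^*_{t,x_0}=J_{t,x_0}(\mathbf{u}^*,\mathbf{x}^* )$. Standing assumptions: for every $x\in X$ and $t\in\{t_0,\dots,T-1\}$ the problem $P(t,x)$ has a solution, so that $J^*_{t,x}$ is well defined; and $\Gamma_{t,x}=\{u\in U: f[x,u,t]\in X\}$ is nonempty for all $x\in X$ and all $t$. *)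

theory Defs
  imports "HOL-Analysis.Analysis"
begin

(* The tuples (u(t),...,u(T-1)) and (x(t),...,x(T)) are extensional functions on {t..<T}
   and {t..T}, so that distinct functions are distinct tuples.  The initial state x0 itself
   is not required to lie in X.  For t = T the input tuple is the empty one. *)
definition feasible ::
  "(real^'n) set \<Rightarrow> (real^'m) set \<Rightarrow> (real^'n \<Rightarrow> real^'m \<Rightarrow> nat \<Rightarrow> real^'n) \<Rightarrow> nat \<Rightarrow> nat \<Rightarrow> real^'n
    \<Rightarrow> (nat \<Rightarrow> real^'m) \<Rightarrow> (nat \<Rightarrow> real^'n) \<Rightarrow> bool" where
  "feasible X U f T t x0 u x \<longleftrightarrow>
     u \<in> extensional {t..<T} \<and> x \<in> extensional {t..T} \<and>
     x t = x0 \<and>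
     (\<forall>k\<in>{t..<T}. x (Suc k) = f (x k) (u k) k) \<and>
     (\<forall>k\<in>{Suc t..T}. x k \<in> X) \<and>
     (\<forall>k\<in>{t..<T}. u k \<in> U)"

definition total_cost ::
  "(nat \<Rightarrow> real^'n \<Rightarrow> real^'m \<Rightarrow> real) \<Rightarrow> (real^'n \<Rightarrow> real) \<Rightarrow> nat \<Rightarrow> nat
    \<Rightarrow> (nat \<Rightarrow> real^'m) \<Rightarrow> (nat \<Rightarrow> real^'n) \<Rightarrow> real" where
  "total_cost c cT T t u x = (\<Sum>k\<in>{t..<T}. c k (x k) (u k)) + cT (x T)"

definition solves ::
  "(real^'n) set \<Rightarrow> (real^'m) set \<Rightarrow> (real^'n \<Rightarrow> real^'m \<Rightarrow> nat \<Rightarrow> real^'n)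
    \<Rightarrow> (nat \<Rightarrow> real^'n \<Rightarrow> real^'m \<Rightarrow> real) \<Rightarrow> (real^'n \<Rightarrow> real) \<Rightarrow> nat \<Rightarrow> nat \<Rightarrow> real^'n
    \<Rightarrow> (nat \<Rightarrow> real^'m) \<Rightarrow> (nat \<Rightarrow> real^'n) \<Rightarrow> bool" where
  "solves X U f c cT T t x0 u x \<longleftrightarrow>
     feasible X U f T t x0 u x \<and>
     (\<forall>v y. feasible X U f T t x0 v y \<longrightarrow> total_cost c cT T t u x \<le> total_cost c cT T t v y)"

(* All solutions have the same cost, so the description is proper whenever a solution exists.
   For t = T it denotes cT x0: the only feasible state tuple is (x0), and the sum is empty. *)
definition optimal_value ::
  "(real^'n) set \<Rightarrow> (real^'m) set \<Rightarrow> (real^'n \<Rightarrow> real^'m \<Rightarrow> nat \<Rightarrow> real^'n)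
    \<Rightarrow> (nat \<Rightarrow> real^'n \<Rightarrow> real^'m \<Rightarrow> real) \<Rightarrow> (real^'n \<Rightarrow> real) \<Rightarrow> nat \<Rightarrow> nat \<Rightarrow> real^'n \<Rightarrow> real" where
  "optimal_value X U f c cT T t x0 =
     (THE J. \<exists>u x. solves X U f c cT T t x0 u x \<and> J = total_cost c cT T t u x)"

definition admissible_inputs ::
  "(real^'n) set \<Rightarrow> (real^'m) set \<Rightarrow> (real^'n \<Rightarrow> real^'m \<Rightarrow> nat \<Rightarrow> real^'n) \<Rightarrow> nat \<Rightarrow> real^'n
    \<Rightarrow> (real^'m) set" where
  "admissible_inputs X U f t x = {u \<in> U. f x u t \<in> X}"

end

theory Submission
  imports Defs
begin

text \<open>
  This is Bellman's principle of optimality. A feasible pair of the problem from \<open>(t, x)\<close> is the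
  same thing as a first input \<open>w\<close> with \<open>w \<in> U\<close> and \<open>f x w t \<in> X\<close>, followed by a feasible pair of
  the problem from \<open>(t + 1, f x w t)\<close>, and the cost is additive along this splitting
  (\<open>feasible_prepend\<close> and \<open>feasible_tail\<close> with their cost lemmas). Putting \<open>w\<close> in front of an
  optimal continuation shows that the optimal value is at most every member of the infimum.
  Conversely, the tail of an optimal pair from \<open>(t, x)\<close> costs at least the optimal value of the
  remaining problem, so the first input of an optimal pair yields a member of the infimum that does
  not exceed the optimal value. The infimum is therefore a minimum, which is why its value as an
  extended real is finite.
\<close>

text \<open>
  Any two solutions are feasible for each other's minimality condition, so the definite
  description is unambiguous.
\<close>
lemma optimal_value_eq_total_cost:
  assumes "solves X U f c cT T t x u xs"
  shows "optimal_value X U f c cT T t x = total_cost c cT T t u xs"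
  unfolding optimal_value_def
proof (rule the_equality)
  show "\<exists>v y. solves X U f c cT T t x v y \<and> total_cost c cT T t u xs = total_cost c cT T t v y"
    using assms by blast
next
  fix J
  assume "\<exists>v y. solves X U f c cT T t x v y \<and> J = total_cost c cT T t v y"
  then obtain v y where "solves X U f c cT T t x v y" "J = total_cost c cT T t v y"
    by blast
  with assms show "J = total_cost c cT T t u xs"
    unfolding solves_def by (meson order_antisym)
qed

lemma optimal_value_le_total_cost:
  assumes "\<exists>u xs. solves X U f c cT T t x u xs" and "feasible X U f T t x v y"
  shows "optimal_value X U f c cT T t x \<le> total_cost c cT T t v y"
proof -
  obtain u xs where "solves X U f c cT T t x u xs"
    using assms(1) by blast
  then show ?thesis
    using assms(2) by (auto simp: optimal_value_eq_total_cost solves_def)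
qed

text \<open>
  At the final time the only feasible pair consists of the empty input tuple and the tuple \<open>(x)\<close>;
  as extensional functions these take the value \<open>undefined\<close> off \<open>{}\<close> and \<open>{T}\<close>.
\<close>
lemma solves_terminal:
  "solves X U f c cT T T x (\<lambda>_. undefined) ((\<lambda>_. undefined)(T := x))"
  by (auto simp: solves_def feasible_def total_cost_def extensional_def)

lemma optimal_value_terminal: "optimal_value X U f c cT T T x = cT x"
  using optimal_value_eq_total_cost[OF solves_terminal]
  by (simp add: total_cost_def)

lemma feasible_prepend:
  assumes "t < T" and "w \<in> admissible_inputs X U f t x"
    and "feasible X U f T (Suc t) (f x w t) v y"
  shows "feasible X U f T t x (v(t := w)) (y(t := x))"
  unfolding feasible_def
proof (intro conjI ballI)
  show "v(t := w) \<in> extensional {t..<T}" and "y(t := x) \<in> extensional {t..T}"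
    using assms by (auto simp: feasible_def extensional_def)
  show "(y(t := x)) t = x" by simp
next
  fix k assume k: "k \<in> {t..<T}"
  show "(y(t := x)) (Suc k) = f ((y(t := x)) k) ((v(t := w)) k) k"
    and "(v(t := w)) k \<in> U"
    using k assms by (auto simp: feasible_def admissible_inputs_def)
next
  \<comment> \<open>The state at time \<open>t + 1\<close> is the initial state of the remaining problem, hence unconstrained
     there; it lies in \<open>X\<close> because \<open>w\<close> is admissible.\<close>
  fix k assume "k \<in> {Suc t..T}"
  then have "k = Suc t \<or> k \<in> {Suc (Suc t)..T}" by auto
  then show "(y(t := x)) k \<in> X"
    using assms by (auto simp: feasible_def admissible_inputs_def)
qed

lemma total_cost_prepend:
  assumes "t < T"
  shows "total_cost c cT T t (v(t := w)) (y(t := x)) = c t x w + total_cost c cT T (Suc t) v y"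
  using assms by (simp add: total_cost_def sum.atLeast_Suc_lessThan)

lemma first_input_admissible:
  assumes "feasible X U f T t x u xs" and "t < T"
  shows "u t \<in> admissible_inputs X U f t x"
proof -
  have "Suc t \<in> {Suc t..T}" and "t \<in> {t..<T}"
    using assms(2) by auto
  then have "xs (Suc t) \<in> X" and "xs (Suc t) = f x (u t) t" and "u t \<in> U"
    using assms(1) unfolding feasible_def by blast+
  then show ?thesis by (simp add: admissible_inputs_def)
qed

lemma feasible_tail:
  assumes "feasible X U f T t x u xs" and "t < T"
  shows "feasible X U f T (Suc t) (f x (u t) t)
           (restrict u {Suc t..<T}) (restrict xs {Suc t..T})"
  using assms by (auto simp: feasible_def)

lemma total_cost_tail:
  assumes "feasible X U f T t x u xs" and "t < T"
  shows "total_cost c cT T t u xs = c t x (u t) +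
           total_cost c cT T (Suc t) (restrict u {Suc t..<T}) (restrict xs {Suc t..T})"
  using assms by (auto simp: total_cost_def feasible_def sum.atLeast_Suc_lessThan)

text \<open>
  Putting the admissible input in front of an optimal continuation gives a feasible pair.
\<close>
lemma optimal_value_le_step:
  assumes "t < T" and "w \<in> admissible_inputs X U f t x"
    and "\<exists>u xs. solves X U f c cT T t x u xs"
    and "\<exists>v y. solves X U f c cT T (Suc t) (f x w t) v y"
  shows "optimal_value X U f c cT T t x
           \<le> c t x w + optimal_value X U f c cT T (Suc t) (f x w t)"
proof -
  obtain v y where vy: "solves X U f c cT T (Suc t) (f x w t) v y"
    using assms(4) by blast
  then have "feasible X U f T t x (v(t := w)) (y(t := x))"
    using assms(1,2) by (intro feasible_prepend) (auto simp: solves_def)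
  from optimal_value_le_total_cost[OF assms(3) this] show ?thesis
    using assms(1) vy by (simp add: total_cost_prepend optimal_value_eq_total_cost)
qed

text \<open>
  The tail of an optimal pair is feasible for the problem that starts at its second state, so it
  costs at least the optimal value there.
\<close>
lemma optimal_value_ge_step:
  assumes "t < T" and "solves X U f c cT T t x u xs"
    and "\<exists>v y. solves X U f c cT T (Suc t) (f x (u t) t) v y"
  shows "c t x (u t) + optimal_value X U f c cT T (Suc t) (f x (u t) t)
           \<le> optimal_value X U f c cT T t x"
proof -
  have feas: "feasible X U f T t x u xs"
    using assms(2) by (simp add: solves_def)
  from optimal_value_le_total_cost[OF assms(3) feasible_tail[OF feas assms(1)]] show ?thesis
    using assms(2) by (simp add: optimal_value_eq_total_cost total_cost_tail[OF feas assms(1)])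
qed

theorem proposition1:
  fixes X :: "(real^'n) set" and U :: "(real^'m) set"
    and f :: "real^'n \<Rightarrow> real^'m \<Rightarrow> nat \<Rightarrow> real^'n"
    and c :: "nat \<Rightarrow> real^'n \<Rightarrow> real^'m \<Rightarrow> real" and cT :: "real^'n \<Rightarrow> real"
    and T t0 :: nat
    and F :: "real^'n \<Rightarrow> nat \<Rightarrow> real"
  assumes "t0 < T"
    and "\<And>t x. t \<in> {t0..<T} \<Longrightarrow> x \<in> X \<Longrightarrow> \<exists>us xs. solves X U f c cT T t x us xs"
    and "\<And>t x. t \<in> {t0..<T} \<Longrightarrow> x \<in> X \<Longrightarrow> admissible_inputs X U f t x \<noteq> {}"
    and "\<And>t x. t \<in> {t0..T} \<Longrightarrow> x \<in> X \<Longrightarrow> F x t = optimal_value X U f c cT T t x"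
  shows "\<forall>x\<in>X.
           (\<forall>t\<in>{t0..<T}. ereal (F x t) =
              (INF u\<in>admissible_inputs X U f t x. ereal (c t x u + F (f x u t) (t + 1)))) \<and>
           F x T = cT x"
proof (intro ballI conjI)
  fix x assume "x \<in> X"
  then show "F x T = cT x"
    using assms(1,4) by (simp add: optimal_value_terminal)
next
  fix x t assume x: "x \<in> X" and t: "t \<in> {t0..<T}"
  \<comment> \<open>The Bellman step at \<open>t = T - 1\<close> refers to the problem at time \<open>T\<close>, which is solvable too.\<close>
  have solvable: "\<exists>us xs. solves X U f c cT T s z us xs" if "s \<in> {t0..T}" "z \<in> X" for s z
  proof (cases "s = T")
    case True
    then show ?thesis using solves_terminal by blast
  next
    case False
    then show ?thesis using that by (intro assms(2)) auto
  qed
  have next_in_X: "f x w t \<in> X" if "w \<in> admissible_inputs X U f t x" for w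
    using that by (simp add: admissible_inputs_def)
  have F_next: "F (f x w t) (t + 1) = optimal_value X U f c cT T (Suc t) (f x w t)"
    and solvable_next: "\<exists>us xs. solves X U f c cT T (Suc t) (f x w t) us xs"
    if "w \<in> admissible_inputs X U f t x" for w
    using assms(4)[of "Suc t" "f x w t"] solvable[of "Suc t" "f x w t"] next_in_X[OF that] t
    by auto
  have F_now: "F x t = optimal_value X U f c cT T t x"
    using assms(4) x t by simp
  obtain u xs where sol: "solves X U f c cT T t x u xs"
    using assms(2) x t by blast
  have adm: "u t \<in> admissible_inputs X U f t x"
    using sol t by (intro first_input_admissible[of _ _ _ T]) (auto simp: solves_def)
  show "ereal (F x t) =
      (INF u\<in>admissible_inputs X U f t x. ereal (c t x u + F (f x u t) (t + 1)))"
  proof (rule antisym)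
    show "ereal (F x t) \<le>
        (INF u\<in>admissible_inputs X U f t x. ereal (c t x u + F (f x u t) (t + 1)))"
    proof (rule INF_greatest)
      fix w assume w: "w \<in> admissible_inputs X U f t x"
      show "ereal (F x t) \<le> ereal (c t x w + F (f x w t) (t + 1))"
        unfolding F_now F_next[OF w] ereal_less_eq
        using optimal_value_le_step[OF _ w _ solvable_next[OF w]] sol t by auto
    qed
    show "(INF u\<in>admissible_inputs X U f t x. ereal (c t x u + F (f x u t) (t + 1)))
        \<le> ereal (F x t)"
    proof (rule INF_lower2[OF adm])
      show "ereal (c t x (u t) + F (f x (u t) t) (t + 1)) \<le> ereal (F x t)"
        unfolding F_now F_next[OF adm] ereal_less_eq
        using optimal_value_ge_step[OF _ sol solvable_next[OF adm]] t by auto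
    qed
  qed
qed

end
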